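(* Let $n\geq m\geq k\geq 1$ be integers. If $A$ is a $(0,1)$-matrix of size $m\times n$, then $$\|A\|_{F_k}\leq \frac12\left(1+\sqrt{k}\right)\sqrt{mn}.$$ Equality holds if and only if the matrix $2A-J_{m,n}$ is plain and has exactly $k$ nonzero singular values, which are equal. In particular, if $m=n=k$, equality holds if and only if $2A-J_{m}$ is a plain Hadamard matrix.
   Context: For a complex $m\times n$ matrix $A$, $\sigma_1(A)\geq\sigma_2(A)\geq\cdots\geq\sigma_{m}(A)$ (with $m\le n$) denote its singular values, i.e. the square roots of the eigenvalues of $AA^*$ listed with multiplicity, and for $1\le k\le m$ the Ky Fan $k$-norm is $\|A\|_{F_k}=\sigma_1(A)+\cdots+\sigma_k(A)$. "Exactly $k$ nonzero singular values" is counted with multiplicity. $J_{m,n}$ is the all-ones $m\times n$ matrix and $J_m=J_{m,m}$. Let $\mathbf{j}_m\in\mathbb{R}^m$, $\mathbf{j}_n\in\mathbb{R}^n$ be the all-ones vectors. An $m\times n$ matrix $B$ is called plain if $\mathbf{j}_m$ and $\mathbf{j}_n$ are singular vectors to $\sigma_1(B)$, that is, $\sigma_1(B)=\langle \mathbf{j}_m,B\mathbf{j}_n\rangle/\sqrt{mn}$. A Hadamard matrix is a square $(-1,1)$-matrix with pairwise orthogonal rows. *)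

theory Defs
  imports
    "Jordan_Normal_Form.Char_Poly"
    "Jordan_Normal_Form.Schur_Decomposition"
    "HOL-Library.Multiset"
    "HOL-Computational_Algebra.Fundamental_Theorem_Algebra"
begin

text \<open>
  The square roots of the eigenvalues of \<open>A A\<^sup>*\<close> in descending order, each repeated according to
  its multiplicity as a root of the characteristic polynomial. The matrix \<open>A A\<^sup>*\<close> is Hermitian and
  positive semidefinite, so its eigenvalues are real and nonnegative (taking real parts loses
  nothing) and their algebraic and geometric multiplicities agree. The list has
  \<open>dim_row A\<close> entries; this is the usual convention when \<open>dim_row A \<le> dim_col A\<close>.
\<close>

definition singular_values :: "complex mat \<Rightarrow> real list" where
  "singular_values A =
     rev (sorted_list_of_multiset
       (image_mset (\<lambda>z. sqrt (Re z)) (proots (char_poly (A * mat_adjoint A)))))"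

lemma length_singular_values: "length (singular_values A) = dim_row A"
proof -
  have "A * mat_adjoint A \<in> carrier_mat (dim_row A) (dim_row A)"
    by (auto simp: mat_adjoint_def)
  from degree_monic_char_poly[OF this] show ?thesis
    unfolding singular_values_def
    by (simp add: size_proots_complex flip: size_mset)
qed

text \<open>The index of the \<open>i\<close>-th largest singular value starts at \<open>i = 1\<close>.\<close>

definition singular_value :: "complex mat \<Rightarrow> nat \<Rightarrow> real" where
  "singular_value A i = singular_values A ! (i - 1)"

definition ky_fan_norm :: "nat \<Rightarrow> complex mat \<Rightarrow> real" where
  "ky_fan_norm k A = (\<Sum>i=1..k. singular_value A i)"

definition zero_one_mat :: "complex mat \<Rightarrow> bool" where
  "zero_one_mat A \<longleftrightarrow> elements_mat A \<subseteq> {0, 1}"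

definition ones_mat :: "nat \<Rightarrow> nat \<Rightarrow> complex mat" where
  "ones_mat m n = mat m n (\<lambda>_. 1)"

definition ones_vec :: "nat \<Rightarrow> complex vec" where
  "ones_vec n = vec n (\<lambda>_. 1)"

text \<open>
  The equation is one between complex numbers, so it also says that the inner product on the
  right is real and nonnegative. Since \<open>x \<bullet>c y\<close> is conjugate-linear in its second argument, the
  all-ones vector is put there.
\<close>

definition plain :: "complex mat \<Rightarrow> bool" where
  "plain B \<longleftrightarrow>
     complex_of_real (singular_value B 1) =
       ((B *\<^sub>v ones_vec (dim_col B)) \<bullet>c ones_vec (dim_row B))
         / complex_of_real (sqrt (real (dim_row B) * real (dim_col B)))"

definition exactly_nonzero_singular_values :: "nat \<Rightarrow> complex mat \<Rightarrow> bool" where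
  "exactly_nonzero_singular_values k B \<longleftrightarrow>
     card {i \<in> {1..dim_row B}. singular_value B i \<noteq> 0} = k"

definition nonzero_singular_values_equal :: "complex mat \<Rightarrow> bool" where
  "nonzero_singular_values_equal B \<longleftrightarrow>
     (\<forall>i \<in> {1..dim_row B}. \<forall>j \<in> {1..dim_row B}.
        singular_value B i \<noteq> 0 \<longrightarrow> singular_value B j \<noteq> 0 \<longrightarrow>
        singular_value B i = singular_value B j)"

definition hadamard_mat :: "complex mat \<Rightarrow> bool" where
  "hadamard_mat H \<longleftrightarrow>
     square_mat H \<and> elements_mat H \<subseteq> {-1, 1} \<and>
     (\<forall>i<dim_row H. \<forall>j<dim_row H. i \<noteq> j \<longrightarrow> row H i \<bullet>c row H j = 0)"

end

theory Submission
  imports Defs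
begin

text \<open>
  Put \<open>B = 2 A - J\<close>, a matrix with entries \<open>\<plusminus>1\<close>, \<open>s = \<surd>(m n)\<close> and \<open>c = s / \<surd>k\<close>. Cutting off the
  singular value decomposition of \<open>A\<close> after \<open>k\<close> terms yields a partial isometry \<open>X\<close> of rank at most
  \<open>k\<close> with \<open>\<langle>X, A\<rangle> = \<parallel>A\<parallel>\<close> (the Ky Fan norm), so that \<open>2 \<parallel>A\<parallel> = \<langle>X, B\<rangle> + \<langle>X, J\<rangle>\<close>. The first summand
  is at most \<open>\<surd>k s\<close> because \<open>B - c X\<close> has nonnegative Frobenius norm, the second at most \<open>s\<close> because
  \<open>X\<close> is a contraction. Equality forces \<open>B = c X\<close> and \<open>\<langle>B, J\<rangle> = c s\<close>, which says that \<open>B\<close> is plain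
  with exactly \<open>k\<close> nonzero singular values, all equal to \<open>c\<close>. Conversely, for such \<open>B\<close> the spectrum of
  \<open>4 A A\<^sup>*\<close> is computed explicitly: \<open>(c + s)\<^sup>2\<close> once, \<open>c\<^sup>2\<close> with multiplicity \<open>k - 1\<close>, and \<open>0\<close>. Singular
  values enter only through a unitary diagonalization of \<open>A A\<^sup>*\<close> and through traces.
\<close>

section \<open>Adjoints and scalar multiples\<close>

lemma mat_adjoint_dim [simp]: "dim_row (mat_adjoint A) = dim_col A" "dim_col (mat_adjoint A) = dim_row A"
  by (auto simp: mat_adjoint_def)

lemma mat_adjoint_carrier [simp]: "mat_adjoint A \<in> carrier_mat m n \<longleftrightarrow> A \<in> carrier_mat n m"
  by (metis carrier_matD carrier_matI mat_adjoint_dim)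

lemma mat_adjoint_index [simp]:
  "i < dim_col A \<Longrightarrow> j < dim_row A \<Longrightarrow> mat_adjoint A $$ (i, j) = conjugate (A $$ (j, i))"
  by (simp add: mat_adjoint_def mat_of_rows_index)

lemma mat_adjoint_adjoint [simp]: "mat_adjoint (mat_adjoint A) = A"
  by (rule eq_matI) auto

lemma mat_adjoint_mult [simp]:
  fixes A :: "'a :: conjugatable_field mat"
  assumes "dim_col A = dim_row B"
  shows "mat_adjoint (A * B) = mat_adjoint B * mat_adjoint A"
  using assms
  by (intro eq_matI)
     (auto simp: scalar_prod_def sum_conjugate conjugate_dist_mul mult.commute intro!: sum.cong)

text \<open>Equations between dimensions replace carrier membership, so that the simplifier can
  discharge the side conditions while regrouping long products.\<close>

lemma mult_assoc_mat_dim: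
  fixes A :: "'a :: semiring_0 mat"
  shows "dim_col A = dim_row B \<Longrightarrow> dim_col B = dim_row C \<Longrightarrow> A * B * C = A * (B * C)"
  by (rule assoc_mult_mat) auto

lemma smult_mult_mat_dim [simp]:
  fixes A B :: "'a :: comm_semiring_0 mat"
  assumes "dim_col A = dim_row B"
  shows "(c \<cdot>\<^sub>m A) * B = c \<cdot>\<^sub>m (A * B)" "A * (c \<cdot>\<^sub>m B) = c \<cdot>\<^sub>m (A * B)"
  using assms by (auto intro!: eq_matI)

lemma smult_smult_mat [simp]: "c \<cdot>\<^sub>m (d \<cdot>\<^sub>m A) = (c * d) \<cdot>\<^sub>m A" for A :: "'a :: semigroup_mult mat"
  by (rule eq_matI) (auto simp: mult.assoc)

lemma mat_adjoint_smult [simp]: "mat_adjoint (c \<cdot>\<^sub>m A) = conjugate c \<cdot>\<^sub>m mat_adjoint A"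
  by (rule eq_matI) (auto simp: conjugate_dist_mul)

lemma mat_adjoint_add [simp]:
  "dim_row A = dim_row B \<Longrightarrow> dim_col A = dim_col B \<Longrightarrow> mat_adjoint (A + B) = mat_adjoint A + mat_adjoint B"
  by (rule eq_matI) (auto simp: conjugate_dist_add)

lemma one_smult_mat [simp]: "1 \<cdot>\<^sub>m A = A" for A :: "'a :: monoid_mult mat"
  by (rule eq_matI) auto

section \<open>Unitary diagonalization of Hermitian matrices\<close>

text \<open>Gram-Schmidt delivers orthogonal vectors that need not have length one; dividing each by
  its norm makes them the columns of a unitary matrix. Only \<open>mat_adjoint W * W\<close> is
  computed, since a one-sided inverse of a square matrix is two-sided.\<close>

lemma corthogonal_normalized:
  fixes ws :: "complex vec list"
  assumes ws: "set ws \<subseteq> carrier_vec n" and o: "corthogonal ws" and len: "length ws = n"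
  defines "W \<equiv> mat_of_cols n (map (\<lambda>w. complex_of_real (1 / sqrt (Re (w \<bullet>c w))) \<cdot>\<^sub>v w) ws)"
  shows "W \<in> carrier_mat n n" "mat_adjoint W * W = 1\<^sub>m n" "W * mat_adjoint W = 1\<^sub>m n"
proof -
  show W: "W \<in> carrier_mat n n" using len by (auto simp: W_def)
  show 1: "mat_adjoint W * W = 1\<^sub>m n"
  proof (rule eq_matI, unfold index_one_mat)
    fix i j assume ij: "i < n" "j < n"
    define r where "r = (\<lambda>i. 1 / sqrt (Re (ws ! i \<bullet>c ws ! i)))"
    have wsi: "ws ! i \<in> carrier_vec n" "ws ! j \<in> carrier_vec n" using ws len ij by auto
    have ind: "W $$ (a, b) = complex_of_real (r b) * (ws ! b $ a)" if "a < n" "b < n" for a b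
    proof -
      have "ws ! b \<in> carrier_vec n" using ws len that by auto
      thus ?thesis using that len by (auto simp: W_def mat_of_cols_def r_def)
    qed
    have "(mat_adjoint W * W) $$ (i, j) = (\<Sum>l<n. cnj (W $$ (l, i)) * W $$ (l, j))"
      using W ij by (auto simp: scalar_prod_def atLeast0LessThan intro!: sum.cong)
    also have "\<dots> = complex_of_real (r i * r j) * (\<Sum>l<n. ws ! j $ l * cnj (ws ! i $ l))"
      using ij by (simp add: ind sum_distrib_left mult_ac)
    also have "(\<Sum>l<n. ws ! j $ l * cnj (ws ! i $ l)) = ws ! j \<bullet>c ws ! i"
      using wsi by (auto simp: scalar_prod_def atLeast0LessThan)
    also have "complex_of_real (r i * r j) * \<dots> = (if i = j then 1 else 0)"
    proof (cases "i = j")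
      case True
      have pos: "ws ! i \<bullet>c ws ! i \<noteq> 0" using corthogonalD[OF o, of i i] ij len by auto
      have "ws ! i \<bullet>c ws ! i \<ge> 0" by (rule conjugate_square_ge_0_vec)
      hence "ws ! i \<bullet>c ws ! i = complex_of_real (Re (ws ! i \<bullet>c ws ! i))"
        "Re (ws ! i \<bullet>c ws ! i) > 0"
        using pos by (auto simp: complex_eq_iff less_eq_complex_def)
      moreover from this(2) have "r i * r i = 1 / Re (ws ! i \<bullet>c ws ! i)" by (simp add: r_def)
      ultimately show ?thesis using True by (metis of_real_mult nonzero_eq_divide_eq of_real_1 pos
         less_irrefl)
    next
      case False
      thus ?thesis using corthogonalD[OF o, of j i] ij len by auto
    qed
    finally show "(mat_adjoint W * W) $$ (i, j) = (if i = j then 1 else 0)" .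
  qed (use W in auto)
  show "W * mat_adjoint W = 1\<^sub>m n" using mat_mult_left_right_inverse[OF _ W 1] W by simp
qed

text \<open>Hermitian symmetry carries the zeros of the first column over to the first row, so a
  Hermitian block of size \<open>n\<close> splits off. This is the deflation step of the
  diagonalization.\<close>

lemma hermitian_first_col_block:
  fixes A :: "complex mat"
  assumes A: "A \<in> carrier_mat (Suc n) (Suc n)" and herm: "mat_adjoint A = A"
    and col: "\<And>i. i < Suc n \<Longrightarrow> A $$ (i, 0) = (if i = 0 then e else 0)"
  obtains A' where "A' \<in> carrier_mat n n" "mat_adjoint A' = A'"
    "A = four_block_mat (mat 1 1 (\<lambda>_. e)) (0\<^sub>m 1 n) (0\<^sub>m n 1) A'"
proof
  let ?A' = "mat n n (\<lambda>(i, j). A $$ (Suc i, Suc j))"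
  have sym: "cnj (A $$ (j, i)) = A $$ (i, j)" if "i < Suc n" "j < Suc n" for i j
    using arg_cong[OF herm, of "\<lambda>M. M $$ (i, j)"] A that by simp
  show "?A' \<in> carrier_mat n n" by simp
  show "mat_adjoint ?A' = ?A'" using A sym by (intro eq_matI) auto
  have row: "A $$ (0, i) = 0" if "0 < i" "i < Suc n" for i
    using sym[of 0 i] col[of i] that by simp
  show "A = four_block_mat (mat 1 1 (\<lambda>_. e)) (0\<^sub>m 1 n) (0\<^sub>m n 1) ?A'"
    using A col row by (intro eq_matI) (auto simp: four_block_mat_def Let_def)
qed

text \<open>Induction on the list of eigenvalues: an eigenvector for the head is extended to an
  orthonormal basis, and the complementary block is diagonalized by the induction hypothesis. The
  order of \<open>es\<close> is prescribed by the caller, so that diagonal entries can later be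
  matched with the sorted singular values.\<close>

theorem hermitian_diagonalization:
  fixes M :: "complex mat"
  assumes "M \<in> carrier_mat n n" and "mat_adjoint M = M"
    and "char_poly M = (\<Prod>e\<leftarrow>es. [:- e, 1:])"
  shows "\<exists>U \<in> carrier_mat n n. mat_adjoint U * U = 1\<^sub>m n \<and> U * mat_adjoint U = 1\<^sub>m n \<and>
           M = U * mat_diag n ((!) es) * mat_adjoint U"
  using assms
proof (induction es arbitrary: n M)
  case Nil
  have "n = 0" using degree_monic_char_poly[OF Nil.prems(1)] Nil.prems(3) by simp
  thus ?case using Nil.prems(1)
    by (intro bexI[of _ "1\<^sub>m 0"]) (auto intro!: eq_matI)
next
  case (Cons e es)
  note M = Cons.prems(1) and herm = Cons.prems(2) and cp = Cons.prems(3)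
  have "n = Suc (length es)"
    using degree_monic_char_poly[OF M] degree_linear_factors[of uminus "e # es"]
    unfolding cp by simp
  then obtain k where n: "n = Suc k" by auto
  have e: "eigenvalue M e" unfolding eigenvalue_root_char_poly[OF M] cp by simp
  then obtain v where v: "v \<in> carrier_vec n" "v \<noteq> 0\<^sub>v n" "M *\<^sub>v v = e \<cdot>\<^sub>v v"
    using M by (auto simp: eigenvalue_def eigenvector_def)
  interpret cof_vec_space n "TYPE(complex)" .
  define b where "b = basis_completion v"
  define ws where "ws = gram_schmidt n b"
  note bc = basis_completion[OF v(1,2), folded b_def]
  obtain vs where bv: "b = v # vs" using bc(6,7) n by (cases b) auto
  note gs = gram_schmidt_result[OF bc(2,4,5) ws_def]
  have len: "length ws = n" using gs(4) bc(6) by simp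
  \<comment> \<open>Gram-Schmidt leaves its first input unchanged, so the first column of
    \<open>W\<close> is a multiple of the eigenvector \<open>v\<close> and \<open>A\<close> gets
    first column \<open>(e, 0, ..., 0)\<close>.\<close>
  have hd: "hd ws = v" using gram_schmidt_hd[OF v(1), of vs] by (simp add: ws_def bv)
  define W where "W = mat_of_cols n (map (\<lambda>w. complex_of_real (1 / sqrt (Re (w \<bullet>c w))) \<cdot>\<^sub>v w) ws)"
  note W = corthogonal_normalized[OF gs(3,2) len, folded W_def]
  define A where "A = mat_adjoint W * M * W"
  have A: "A \<in> carrier_mat n n" using W M by (auto simp: A_def)
  have sim: "similar_mat A M"
    by (rule similar_matI[of _ _ "mat_adjoint W" W n]) (use A M W in \<open>auto simp: A_def\<close>)
  have "mat_adjoint A = A" using W M herm by (simp add: A_def mult_assoc_mat_dim)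
  moreover have "A $$ (i, 0) = (if i = 0 then e else 0)" if i: "i < Suc k" for i
  proof -
    define r where "r = complex_of_real (1 / sqrt (Re (v \<bullet>c v)))"
    have ws0: "ws ! 0 = v" using hd len n by (cases ws) auto
    have c: "col W 0 = r \<cdot>\<^sub>v v"
      using len n ws0 v(1) unfolding W_def by (subst col_mat_of_cols) (auto simp: r_def)
    have "M *\<^sub>v col W 0 = r \<cdot>\<^sub>v (M *\<^sub>v v)" unfolding c by (rule mult_mat_vec[OF M v(1)])
    hence ev: "M *\<^sub>v col W 0 = e \<cdot>\<^sub>v col W 0" unfolding c v(3) by (simp add: smult_smult_assoc mult.commute)
    have "col (mat_adjoint W * (M * W)) 0 = mat_adjoint W *\<^sub>v col (M * W) 0"
      by (rule col_mult2) (use W M n in auto)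
    also have "col (M * W) 0 = M *\<^sub>v col W 0" using W M n by (subst col_mult2) auto
    also have "mat_adjoint W *\<^sub>v (M *\<^sub>v col W 0) = e \<cdot>\<^sub>v (mat_adjoint W *\<^sub>v col W 0)"
      unfolding ev using W(1) col_dim[of W 0] by (intro mult_mat_vec[of _ n n]) (simp_all only: mat_adjoint_carrier carrier_matD)
    also have "mat_adjoint W *\<^sub>v col W 0 = col (mat_adjoint W * W) 0"
      using W n by (subst col_mult2) auto
    also have "\<dots> = unit_vec n 0" unfolding W(2) using n by simp
    finally have "col A 0 = e \<cdot>\<^sub>v unit_vec n 0" using W M by (simp add: A_def mult_assoc_mat_dim)
    from arg_cong[OF this, of "\<lambda>v. v $ i"] show ?thesis using A i n by simp
  qed
  ultimately obtain A' where A': "A' \<in> carrier_mat k k" "mat_adjoint A' = A'"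
    and blk: "A = four_block_mat (mat 1 1 (\<lambda>_. e)) (0\<^sub>m 1 k) (0\<^sub>m k 1) A'"
    using hermitian_first_col_block[of A k e] A n by blast
  \<comment> \<open>Splitting off the block removes exactly the factor of \<open>e\<close> from the
    characteristic polynomial; what is left is the hypothesis needed for \<open>A'\<close>.\<close>
  have "[:-e, 1:] * (\<Prod>e\<leftarrow>es. [:- e, 1:]) = char_poly A"
    using char_poly_similar[OF sim] cp by simp
  also have "\<dots> = char_poly (mat 1 1 (\<lambda>_. e)) * char_poly A'"
    unfolding blk by (rule char_poly_four_block_zeros_col) (use A' in auto)
  also have "char_poly (mat 1 1 (\<lambda>_. e)) = [:-e, 1:]"
    by (simp add: char_poly_defs det_def sign_def)
  finally have "char_poly A' = (\<Prod>e\<leftarrow>es. [:- e, 1:])"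
    by (metis mult_cancel_left pCons_eq_0_iff zero_neq_one)
  from Cons.IH[OF A' this] obtain V where V: "V \<in> carrier_mat k k" "mat_adjoint V * V = 1\<^sub>m k"
    "V * mat_adjoint V = 1\<^sub>m k" "A' = V * mat_diag k ((!) es) * mat_adjoint V" by auto
  define V' where "V' = four_block_mat (1\<^sub>m 1) (0\<^sub>m 1 k) (0\<^sub>m k 1) V"
  have V': "V' \<in> carrier_mat n n" using V n unfolding V'_def by (metis four_block_carrier_mat one_carrier_mat plus_1_eq_Suc)
  have adj: "mat_adjoint V' = four_block_mat (1\<^sub>m 1) (0\<^sub>m 1 k) (0\<^sub>m k 1) (mat_adjoint V)"
    using V(1) unfolding V'_def by (intro eq_matI) (auto simp: four_block_mat_def Let_def)
  have diag: "mat_diag n ((!) (e # es)) = four_block_mat (mat 1 1 (\<lambda>_. e)) (0\<^sub>m 1 k) (0\<^sub>m k 1) (mat_diag k ((!) es))"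
    unfolding n by (intro eq_matI) (auto simp: four_block_mat_def Let_def mat_diag_def nth_Cons')
  note mult = mult_four_block_mat[where ?nr1.0 = 1 and ?n1.0 = 1 and ?n2.0 = k and ?nr2.0 = k and ?nc1.0 = 1 and ?nc2.0 = k]
  have one: "four_block_mat (1\<^sub>m 1) (0\<^sub>m 1 k) (0\<^sub>m k 1) (1\<^sub>m k) = 1\<^sub>m n" using n by simp
  have V'1: "mat_adjoint V' * V' = 1\<^sub>m n" "V' * mat_adjoint V' = 1\<^sub>m n"
    unfolding adj unfolding V'_def using V(1-3)
    by (subst mult; auto simp: n simp flip: one)+
  have AV': "A = V' * mat_diag n ((!) (e # es)) * mat_adjoint V'"
  proof -
    have "V' * mat_diag n ((!) (e # es)) =
        four_block_mat (mat 1 1 (\<lambda>_. e)) (0\<^sub>m 1 k) (0\<^sub>m k 1) (V * mat_diag k ((!) es))"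
      unfolding V'_def diag using V(1) by (subst mult) (auto simp: left_mult_zero_mat[OF mat_diag_dim])
    also have "\<dots> * mat_adjoint V' = A"
    proof -
      have "V * mat_diag k ((!) es) \<in> carrier_mat k k"
        "V * mat_diag k ((!) es) * mat_adjoint V \<in> carrier_mat k k"
        using V(1) by (auto intro!: mult_carrier_mat[of _ k k _ k])
      thus ?thesis unfolding adj blk V(4) using V(1)
        by (subst mult) (simp_all add: right_mult_zero_mat[of _ k k])
    qed
    finally show ?thesis ..
  qed
  have "(W * V') * mat_diag n ((!) (e # es)) * mat_adjoint (W * V') = W * A * mat_adjoint W"
    unfolding AV' using W V' by (simp add: mult_assoc_mat_dim mat_diag_def)
  also have "\<dots> = (W * mat_adjoint W) * M * (W * mat_adjoint W)"
    using W(1) M by (simp add: A_def mult_assoc_mat_dim del: W(3))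
  also have "\<dots> = M" using W M by simp
  finally have "M = (W * V') * mat_diag n ((!) (e # es)) * mat_adjoint (W * V')" by simp
  moreover have "mat_adjoint (W * V') * (W * V') = mat_adjoint V' * ((mat_adjoint W * W) * V')"
    "(W * V') * mat_adjoint (W * V') = W * ((V' * mat_adjoint V') * mat_adjoint W)"
    using W(1) V' by (simp_all add: mult_assoc_mat_dim)
  hence "mat_adjoint (W * V') * (W * V') = 1\<^sub>m n" "(W * V') * mat_adjoint (W * V') = 1\<^sub>m n"
    using W V' by (simp_all add: V'1)
  moreover have "W * V' \<in> carrier_mat n n" using W(1) V' by simp
  ultimately show ?case by blast
qed

section \<open>Trace and Frobenius norm\<close>

definition mat_trace :: "complex mat \<Rightarrow> complex" where
  "mat_trace M = (\<Sum>i<dim_row M. M $$ (i, i))"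

lemma mat_trace_mult_index:
  assumes "dim_row A = dim_col B" "dim_col A = dim_row B"
  shows "mat_trace (A * B) = (\<Sum>i<dim_row A. \<Sum>j<dim_col A. A $$ (i, j) * B $$ (j, i))"
  using assms by (auto simp: mat_trace_def scalar_prod_def atLeast0LessThan intro!: sum.cong)

lemma mat_trace_comm:
  assumes "dim_row A = dim_col B" "dim_col A = dim_row B"
  shows "mat_trace (A * B) = mat_trace (B * A)"
proof -
  have "mat_trace (A * B) = (\<Sum>j<dim_col A. \<Sum>i<dim_row A. A $$ (i, j) * B $$ (j, i))"
    unfolding mat_trace_mult_index[OF assms] by (rule sum.swap)
  also have "\<dots> = mat_trace (B * A)"
    using assms by (subst mat_trace_mult_index) (auto simp: mult.commute)
  finally show ?thesis .
qed

lemma mat_trace_smult [simp]: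
  "dim_row M = dim_col M \<Longrightarrow> mat_trace (c \<cdot>\<^sub>m M) = c * mat_trace M"
  by (simp add: mat_trace_def sum_distrib_left)

lemma mat_trace_add [simp]:
  "dim_row A = dim_row B \<Longrightarrow> dim_col A = dim_row B \<Longrightarrow> dim_col B = dim_row B \<Longrightarrow>
   mat_trace (A + B) = mat_trace A + mat_trace B"
  by (simp add: mat_trace_def sum.distrib)

lemma mat_trace_adjoint:
  "dim_row M = dim_col M \<Longrightarrow> mat_trace (mat_adjoint M) = cnj (mat_trace M)"
  by (simp add: mat_trace_def)

definition frob :: "complex mat \<Rightarrow> real" where
  "frob M = (\<Sum>i<dim_row M. \<Sum>j<dim_col M. (cmod (M $$ (i, j)))\<^sup>2)"

lemma frob_nonneg: "frob M \<ge> 0"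
  by (auto simp: frob_def intro!: sum_nonneg)

lemma frob_eq_0_iff: "frob M = 0 \<longleftrightarrow> M = 0\<^sub>m (dim_row M) (dim_col M)"
proof
  assume "frob M = 0"
  hence "cmod (M $$ (i, j)) = 0" if "i < dim_row M" "j < dim_col M" for i j
    using that by (auto simp: frob_def sum_nonneg_eq_0_iff sum_nonneg)
  thus "M = 0\<^sub>m (dim_row M) (dim_col M)" by (intro eq_matI) auto
next
  assume *: "M = 0\<^sub>m (dim_row M) (dim_col M)"
  have "M $$ (i, j) = 0" if "i < dim_row M" "j < dim_col M" for i j
    by (subst *) (use that in auto)
  thus "frob M = 0" by (simp add: frob_def)
qed

lemma mat_trace_mult_adjoint: "mat_trace (M * mat_adjoint M) = complex_of_real (frob M)"
  by (subst mat_trace_mult_index) (auto simp: frob_def complex_norm_square[symmetric] intro!: sum.cong)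

text \<open>The square of a norm of a difference, expanded. The later estimates on traces come from
  its being nonnegative, and their equality cases from its being zero.\<close>

lemma frob_diff_smult:
  assumes "A \<in> carrier_mat m n" "B \<in> carrier_mat m n"
  shows "frob (A - complex_of_real c \<cdot>\<^sub>m B) =
           frob A - 2 * c * Re (mat_trace (A * mat_adjoint B)) + c\<^sup>2 * frob B"
proof -
  have *: "(cmod (x - complex_of_real c * y))\<^sup>2 =
          (cmod x)\<^sup>2 - 2 * c * Re (x * cnj y) + c\<^sup>2 * (cmod y)\<^sup>2" for x y
    unfolding cmod_power2 by (simp add: algebra_simps power2_eq_square)
  show ?thesis using assms
    by (subst mat_trace_mult_index)
       (auto simp: frob_def * sum.distrib sum_subtractf sum_distrib_left distrib_left)
qed

lemma frob_diff_smult_eq_0: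
  assumes "A \<in> carrier_mat m n" "B \<in> carrier_mat m n" "frob (A - c \<cdot>\<^sub>m B) = 0"
  shows "A = c \<cdot>\<^sub>m B"
proof (rule eq_matI)
  have *: "A - c \<cdot>\<^sub>m B = 0\<^sub>m m n" using assms by (simp add: frob_eq_0_iff)
  fix i j assume "i < dim_row (c \<cdot>\<^sub>m B)" "j < dim_col (c \<cdot>\<^sub>m B)"
  thus "A $$ (i, j) = (c \<cdot>\<^sub>m B) $$ (i, j)"
    using arg_cong[OF *, of "\<lambda>M. M $$ (i, j)"] assms(1,2) by simp
qed (use assms in auto)

lemma ones_mat_dim [simp]: "dim_row (ones_mat m n) = m" "dim_col (ones_mat m n) = n"
  by (simp_all add: ones_mat_def)

lemma ones_mat_carrier [simp]: "ones_mat m n \<in> carrier_mat m n"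
  by (simp add: ones_mat_def)

lemma ones_mat_index [simp]: "i < m \<Longrightarrow> j < n \<Longrightarrow> ones_mat m n $$ (i, j) = 1"
  by (simp add: ones_mat_def)

lemma adjoint_ones_mat [simp]: "mat_adjoint (ones_mat m n) = ones_mat n m"
  by (rule eq_matI) auto

lemma ones_mat_mult [simp]: "ones_mat m n * ones_mat n p = of_nat n \<cdot>\<^sub>m ones_mat m p"
  by (rule eq_matI) (auto simp: scalar_prod_def)

lemma frob_ones_mat [simp]: "frob (ones_mat m n) = real m * real n"
  by (simp add: frob_def)

lemma mat_trace_ones_mat [simp]: "mat_trace (ones_mat m m) = of_nat m"
  by (simp add: mat_trace_def)

section \<open>Real functional calculus of a unitary diagonalization\<close>

definition unitary_mat :: "nat \<Rightarrow> complex mat \<Rightarrow> bool" where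
  "unitary_mat n U \<longleftrightarrow> U \<in> carrier_mat n n \<and> mat_adjoint U * U = 1\<^sub>m n \<and> U * mat_adjoint U = 1\<^sub>m n"

text \<open>For fixed unitary \<open>U\<close>, the map from \<open>d\<close> to this matrix is a
  real functional calculus: sums, products, scalar multiples and traces are computed on
  \<open>d\<close>. Only the values of \<open>d\<close> below the dimension matter.\<close>

definition conj_diag :: "complex mat \<Rightarrow> (nat \<Rightarrow> real) \<Rightarrow> complex mat" where
  "conj_diag U d = U * mat_diag (dim_row U) (\<lambda>i. complex_of_real (d i)) * mat_adjoint U"

lemma mat_diag_dims [simp]: "dim_row (mat_diag n d) = n" "dim_col (mat_diag n d) = n"
  by (simp_all add: mat_diag_def)

context
  fixes n :: nat and U :: "complex mat"
  assumes U: "unitary_mat n U"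
begin

lemma unitary_dims [simp]: "dim_row U = n" "dim_col U = n"
  and unitary_cancel: "mat_adjoint U * U = 1\<^sub>m n" "U * mat_adjoint U = 1\<^sub>m n"
  using U by (auto simp: unitary_mat_def)

lemma conj_diag_dim [simp]: "dim_row (conj_diag U d) = n" "dim_col (conj_diag U d) = n"
  by (simp_all add: conj_diag_def)

lemma unitary_cancel_left: "dim_row X = n \<Longrightarrow> mat_adjoint U * (U * X) = X"
  by (subst mult_assoc_mat_dim[symmetric]) (auto simp: unitary_cancel intro: left_mult_one_mat)

lemma adjoint_conj_diag [simp]: "mat_adjoint (conj_diag U d) = conj_diag U d"
proof -
  have "mat_adjoint (mat_diag n (\<lambda>i. complex_of_real (d i))) = mat_diag n (\<lambda>i. complex_of_real (d i))"
    by (rule eq_matI) (auto simp: mat_diag_def)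
  thus ?thesis by (simp add: conj_diag_def mult_assoc_mat_dim)
qed

lemma conj_diag_mult [simp]: "conj_diag U d * conj_diag U e = conj_diag U (\<lambda>i. d i * e i)"
  by (simp add: conj_diag_def mult_assoc_mat_dim unitary_cancel_left flip: mat_diag_diag)

lemma conj_diag_smult: "complex_of_real c \<cdot>\<^sub>m conj_diag U d = conj_diag U (\<lambda>i. c * d i)"
proof -
  have "mat_diag n (\<lambda>i. complex_of_real (c * d i)) =
        complex_of_real c \<cdot>\<^sub>m mat_diag n (\<lambda>i. complex_of_real (d i))"
    by (rule eq_matI) (auto simp: mat_diag_def)
  thus ?thesis
    by (simp add: conj_diag_def mult_smult_assoc_mat[of _ n n _ n] mult_smult_distrib[of _ n n _ n]
       carrier_matI)
qed

lemma conj_diag_add: "conj_diag U d + conj_diag U e = conj_diag U (\<lambda>i. d i + e i)"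
proof -
  have "mat_diag n (\<lambda>i. complex_of_real (d i + e i)) =
        mat_diag n (\<lambda>i. complex_of_real (d i)) + mat_diag n (\<lambda>i. complex_of_real (e i))"
    by (rule eq_matI) (auto simp: mat_diag_def)
  thus ?thesis
    by (simp add: conj_diag_def mult_add_distrib_mat[of _ n n _ n] add_mult_distrib_mat[of _ n n _ _ n]
       carrier_matI)
qed

lemma mat_trace_conj_diag: "mat_trace (conj_diag U d) = complex_of_real (\<Sum>i<n. d i)"
proof -
  have "mat_trace (conj_diag U d) = mat_trace (mat_adjoint U * (U * mat_diag n (\<lambda>i. complex_of_real (d i))))"
    unfolding conj_diag_def by (subst mat_trace_comm) auto
  also have "\<dots> = complex_of_real (\<Sum>i<n. d i)"
    by (simp add: unitary_cancel_left) (simp add: mat_trace_def mat_diag_def)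
  finally show ?thesis .
qed

text \<open>Conjugating back by \<open>U\<close> recovers the diagonal. Identities between matrices
  diagonalized by the same \<open>U\<close> thus become scalar identities, one for each
  eigenvalue.\<close>

lemma conj_diag_eq_iff: "conj_diag U d = conj_diag U e \<longleftrightarrow> (\<forall>i<n. d i = e i)"
proof
  assume "conj_diag U d = conj_diag U e"
  hence "mat_adjoint U * (conj_diag U d * U) = mat_adjoint U * (conj_diag U e * U)" by simp
  hence *: "mat_diag n (\<lambda>i. complex_of_real (d i)) = mat_diag n (\<lambda>i. complex_of_real (e i))"
    by (simp add: conj_diag_def mult_assoc_mat_dim unitary_cancel_left unitary_cancel
          right_mult_one_mat[OF mat_diag_dim])
  show "\<forall>i<n. d i = e i"
  proof (intro allI impI)
    fix i assume "i < n"
    thus "d i = e i" using arg_cong[OF *, of "\<lambda>M. M $$ (i, i)"] by (simp add: mat_diag_def)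
  qed
next
  assume "\<forall>i<n. d i = e i"
  hence "mat_diag n (\<lambda>i. complex_of_real (d i)) = mat_diag n (\<lambda>i. complex_of_real (e i))"
    by (auto simp: mat_diag_def)
  thus "conj_diag U d = conj_diag U e" by (simp add: conj_diag_def)
qed

lemma conj_diag_const: "conj_diag U (\<lambda>_. c) = complex_of_real c \<cdot>\<^sub>m 1\<^sub>m n"
proof -
  have "conj_diag U (\<lambda>_. 1) = 1\<^sub>m n"
    by (simp add: conj_diag_def unitary_cancel right_mult_one_mat[of _ n n] carrier_matI)
  thus ?thesis using conj_diag_smult[of c "\<lambda>_. 1"] by simp
qed

end

section \<open>Singular values\<close>

text \<open>For an eigenvector v of A A* one has z |v|^2 = |A* v|^2. The vector is turned into the
  one-column matrix \<open>V\<close>, so that both sides are traces.\<close>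

lemma gram_eigenvalue_nonneg:
  fixes A :: "complex mat"
  assumes A: "A \<in> carrier_mat m n" and z: "poly (char_poly (A * mat_adjoint A)) z = 0"
  shows "z = complex_of_real (Re z) \<and> Re z \<ge> 0"
proof -
  let ?M = "A * mat_adjoint A"
  have M: "?M \<in> carrier_mat m m" using A by auto
  obtain v where v: "v \<in> carrier_vec m" "v \<noteq> 0\<^sub>v m" "?M *\<^sub>v v = z \<cdot>\<^sub>v v"
    using eigenvalue_root_char_poly[OF M, of z] z M
    by (auto simp: eigenvalue_def eigenvector_def simp del: assoc_mult_mat_vec)
  define V where "V = mat m 1 (\<lambda>(i, _). v $ i)"
  have V: "dim_row V = m" "dim_col V = 1" by (auto simp: V_def)
  have "col V 0 = v" using v(1) by (auto simp: V_def)
  hence ent: "(N * V) $$ (i, 0) = (N *\<^sub>v v) $ i" if "dim_row N = m" "i < m" for N i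
    using that V by simp
  have "?M * V = z \<cdot>\<^sub>m V"
  proof (intro eq_matI, goal_cases)
    case (1 i j)
    hence "(?M * V) $$ (i, j) = (?M *\<^sub>v v) $ i" using ent[of ?M i] A V by simp
    also have "\<dots> = z * v $ i" unfolding v(3) using 1 v(1) V by simp
    finally show ?case using 1 V by (simp add: V_def)
  qed (use M V in auto)
  hence "mat_trace (?M * V * mat_adjoint V) = mat_trace (z \<cdot>\<^sub>m (V * mat_adjoint V))"
    using V by (simp only: mult_smult_assoc_mat[of V m 1 _ m] mat_adjoint_carrier carrier_matI)
  also have "\<dots> = z * complex_of_real (frob V)" by (simp add: mat_trace_mult_adjoint)
  also have "mat_trace (?M * V * mat_adjoint V) = mat_trace (A * (mat_adjoint A * V * mat_adjoint V))"
    using A V by (simp add: mult_assoc_mat_dim)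
  also have "\<dots> = mat_trace ((mat_adjoint A * V) * mat_adjoint (mat_adjoint A * V))"
    using A V by (subst mat_trace_comm) (auto simp: mult_assoc_mat_dim)
  also have "\<dots> = complex_of_real (frob (mat_adjoint A * V))" by (rule mat_trace_mult_adjoint)
  finally have eq: "complex_of_real (frob (mat_adjoint A * V)) = z * complex_of_real (frob V)" .
  have "frob V \<noteq> 0"
  proof
    assume "frob V = 0"
    hence "V = 0\<^sub>m m 1" by (simp add: frob_eq_0_iff V)
    hence "V $$ (i, 0) = 0" if "i < m" for i using that by simp
    hence "v = 0\<^sub>v m" using v(1) by (intro eq_vecI) (auto simp: V_def)
    thus False using v by simp
  qed
  hence "z = complex_of_real (frob (mat_adjoint A * V) / frob V)" using eq by (simp add: field_simps)
  thus ?thesis using frob_nonneg[of V] frob_nonneg[of "mat_adjoint A * V"] by simp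
qed

lemma mset_singular_values:
  "mset (singular_values A) = image_mset (\<lambda>z. sqrt (Re z)) (proots (char_poly (A * mat_adjoint A)))"
  by (simp add: singular_values_def)

text \<open>Membership in \<open>proots\<close> means being a root only for a nonzero
  polynomial.\<close>

lemma char_poly_gram_nonzero: "char_poly (A * mat_adjoint A) \<noteq> 0" for A :: "complex mat"
proof
  assume *: "char_poly (A * mat_adjoint A) = 0"
  have "A * mat_adjoint A \<in> carrier_mat (dim_row A) (dim_row A)" by (rule carrier_matI) simp_all
  from degree_monic_char_poly[OF this] * show False by simp
qed

lemma singular_value_nonneg: "i < dim_row A \<Longrightarrow> singular_values A ! i \<ge> 0"
proof -
  assume "i < dim_row A"
  hence "singular_values A ! i \<in># mset (singular_values A)" by (simp add: length_singular_values)
  thus ?thesis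
    using gram_eigenvalue_nonneg[OF carrier_matI[OF refl refl], of A] char_poly_gram_nonzero[of A]
    unfolding mset_singular_values by auto
qed

lemma singular_values_antimono:
  assumes "i \<le> j" "j < dim_row A"
  shows "singular_values A ! j \<le> singular_values A ! i"
proof -
  have "sorted (rev (singular_values A))" by (simp add: singular_values_def)
  hence "sorted_wrt (\<ge>) (singular_values A)" by (simp add: sorted_wrt_rev)
  thus ?thesis using assms sorted_wrt_nth_less[of "(\<ge>)" "singular_values A" i j]
    by (cases "i = j") (auto simp: length_singular_values)
qed

text \<open>The eigenvalues are real and nonnegative, so taking real part and square root and then
  squaring returns each of them. Hence the squared singular values, in their order, list the roots
  of the characteristic polynomial with multiplicity.\<close>

theorem gram_diagonalization:
  fixes A :: "complex mat"
  assumes A: "A \<in> carrier_mat m n"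
  obtains U where "unitary_mat m U"
    "A * mat_adjoint A = conj_diag U (\<lambda>i. (singular_values A ! i)\<^sup>2)"
proof -
  let ?M = "A * mat_adjoint A" and ?sv = "singular_values A"
  define es where "es = map (\<lambda>s. complex_of_real (s\<^sup>2)) ?sv"
  have M: "?M \<in> carrier_mat m m" "mat_adjoint ?M = ?M" using A by auto
  have len: "length ?sv = m" using A by (simp add: length_singular_values)
  have "mset es = image_mset (\<lambda>z. complex_of_real ((sqrt (Re z))\<^sup>2)) (proots (char_poly ?M))"
    by (simp add: es_def mset_singular_values image_mset.compositionality o_def)
  also have "\<dots> = image_mset (\<lambda>z. z) (proots (char_poly ?M))"
    using gram_eigenvalue_nonneg[OF A] char_poly_gram_nonzero[of A]
    by (intro image_mset_cong) auto
  finally have es: "mset es = proots (char_poly ?M)" by simp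
  have "char_poly ?M = (\<Prod>e\<in>#mset es. [:- e, 1:])"
    using complex_poly_decompose_multiset[of "char_poly ?M"] degree_monic_char_poly[OF M(1)]
    unfolding es by simp
  also have "\<dots> = (\<Prod>e\<leftarrow>es. [:- e, 1:])" by (metis mset_map prod_mset_prod_list)
  finally obtain U where U: "unitary_mat m U" "?M = U * mat_diag m ((!) es) * mat_adjoint U"
    using hermitian_diagonalization[OF M] unfolding unitary_mat_def by blast
  have "mat_diag m ((!) es) = mat_diag m (\<lambda>i. complex_of_real ((?sv ! i)\<^sup>2))"
    using len by (auto simp: es_def mat_diag_def)
  hence "?M = conj_diag U (\<lambda>i. (?sv ! i)\<^sup>2)"
    using U by (simp add: conj_diag_def unitary_dims)
  thus ?thesis using that U(1) by blast
qed

lemma frob_eq_sum_singular_values: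
  assumes "A \<in> carrier_mat m n"
  shows "frob A = (\<Sum>i<m. (singular_values A ! i)\<^sup>2)"
proof -
  obtain U where U: "unitary_mat m U" "A * mat_adjoint A = conj_diag U (\<lambda>i. (singular_values A ! i)\<^sup>2)"
    by (rule gram_diagonalization[OF assms])
  have "complex_of_real (frob A) = complex_of_real (\<Sum>i<m. (singular_values A ! i)\<^sup>2)"
    unfolding mat_trace_mult_adjoint[symmetric] U(2) by (rule mat_trace_conj_diag[OF U(1)])
  thus ?thesis unfolding of_real_eq_iff .
qed

text \<open>On an eigenvalue t the matrix identity reads t^2 = c^2 t. It says, without mentioning
  singular values, that B / c is a partial isometry when \<open>c\<close> is positive and
  \<open>A\<close> is B.\<close>

lemma gram_square_iff_singular_values:
  assumes A: "A \<in> carrier_mat m n" and c: "c \<ge> 0"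
  shows "A * mat_adjoint A * (A * mat_adjoint A) = complex_of_real (c\<^sup>2) \<cdot>\<^sub>m (A * mat_adjoint A) \<longleftrightarrow>
         (\<forall>i<m. singular_values A ! i = 0 \<or> singular_values A ! i = c)"
proof -
  obtain U where U: "unitary_mat m U" "A * mat_adjoint A = conj_diag U (\<lambda>i. (singular_values A ! i)\<^sup>2)"
    by (rule gram_diagonalization[OF A])
  have *: "s\<^sup>2 * s\<^sup>2 = c\<^sup>2 * s\<^sup>2 \<longleftrightarrow> s = 0 \<or> s = c" if "s \<ge> 0" for s
    unfolding mult_cancel_right power2_eq_iff_nonneg[OF that c] by auto
  have "singular_values A ! i \<ge> 0" if "i < m" for i
    using singular_value_nonneg[of i A] A that by simp
  thus ?thesis
    unfolding U(2) conj_diag_mult[OF U(1)] conj_diag_smult[OF U(1)] conj_diag_eq_iff[OF U(1)]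
    by (metis *)
qed

lemma gram_scalar_iff_singular_values:
  assumes A: "A \<in> carrier_mat m n" and c: "c \<ge> 0"
  shows "A * mat_adjoint A = complex_of_real (c\<^sup>2) \<cdot>\<^sub>m 1\<^sub>m m \<longleftrightarrow> (\<forall>i<m. singular_values A ! i = c)"
proof -
  obtain U where U: "unitary_mat m U" "A * mat_adjoint A = conj_diag U (\<lambda>i. (singular_values A ! i)\<^sup>2)"
    by (rule gram_diagonalization[OF A])
  have "singular_values A ! i \<ge> 0" if "i < m" for i
    using singular_value_nonneg[of i A] A that by simp
  thus ?thesis using c
    unfolding U(2) conj_diag_const[OF U(1), symmetric] conj_diag_eq_iff[OF U(1)]
    by (auto simp: power2_eq_iff_nonneg)
qed

section \<open>Sums and counts of singular values\<close>

lemma ky_fan_norm_eq_sum: "ky_fan_norm k A = (\<Sum>i<k. singular_values A ! i)"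
proof -
  have "{1..k} = Suc ` {..<k}" by (auto simp: image_iff Bex_def) presburger
  thus ?thesis by (simp add: ky_fan_norm_def singular_value_def sum.reindex)
qed

lemma card_nonzero_singular_values:
  "exactly_nonzero_singular_values k A \<longleftrightarrow> card {i. i < dim_row A \<and> singular_values A ! i \<noteq> 0} = k"
proof -
  have "{i \<in> {1..dim_row A}. singular_value A i \<noteq> 0} =
        Suc ` {i. i < dim_row A \<and> singular_values A ! i \<noteq> 0}"
  proof (intro equalityI subsetI)
    fix i assume "i \<in> {i \<in> {1..dim_row A}. singular_value A i \<noteq> 0}"
    thus "i \<in> Suc ` {i. i < dim_row A \<and> singular_values A ! i \<noteq> 0}"
      by (intro image_eqI[of _ _ "i - 1"]) (auto simp: singular_value_def)
  qed (auto simp: singular_value_def)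
  thus ?thesis by (simp add: exactly_nonzero_singular_values_def card_image)
qed

text \<open>In a descending list of nonnegative numbers the nonzero entries form an initial segment,
  here of length \<open>k\<close>, so the omitted terms are zero.\<close>

lemma ky_fan_norm_eq_sum_all:
  assumes "card {i. i < dim_row A \<and> singular_values A ! i \<noteq> 0} = k"
  shows "ky_fan_norm k A = (\<Sum>i<dim_row A. singular_values A ! i)"
proof -
  let ?S = "{i. i < dim_row A \<and> singular_values A ! i \<noteq> 0}"
  have "?S \<subseteq> {..<k}"
  proof
    fix i assume i: "i \<in> ?S"
    have "{..i} \<subseteq> ?S"
      using i singular_values_antimono[of _ i A] singular_value_nonneg[of i A] by fastforce
    from card_mono[OF _ this] assms show "i \<in> {..<k}" by simp
  qed
  hence S: "?S = {..<k}" using assms by (intro card_subset_eq) auto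
  have "(\<Sum>i<dim_row A. singular_values A ! i) = (\<Sum>i\<in>?S. singular_values A ! i)"
    by (rule sum.mono_neutral_right) auto
  thus ?thesis unfolding S ky_fan_norm_eq_sum by simp
qed

text \<open>This is the truncated singular value decomposition with its first \<open>k\<close>
  singular values replaced by 1, zero ones staying 0. It is obtained as a function of A A* applied
  to \<open>A\<close>, without right singular vectors.\<close>

lemma ky_fan_norm_partial_isometry:
  assumes A: "A \<in> carrier_mat m n" and k: "k \<le> m"
  obtains X where "X \<in> carrier_mat m n"
    "X * mat_adjoint X * (X * mat_adjoint X) = X * mat_adjoint X"
    "mat_trace (X * mat_adjoint A) = complex_of_real (ky_fan_norm k A)"
    "frob X \<le> real k"
proof -
  let ?\<sigma> = "\<lambda>i. singular_values A ! i"
  obtain U where U: "unitary_mat m U" and N: "A * mat_adjoint A = conj_diag U (\<lambda>i. (?\<sigma> i)\<^sup>2)"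
    by (rule gram_diagonalization[OF A])
  note [simp] = carrier_matD[OF A] conj_diag_dim[OF U] adjoint_conj_diag[OF U] conj_diag_mult[OF U]
  \<comment> \<open>Since \<open>inverse 0 = 0\<close>, zero singular values among the first
    \<open>k\<close> drop out; this is why \<open>frob X\<close> is only bounded by
    \<open>k\<close>.\<close>
  define g where "g = (\<lambda>i. if i < k then inverse (?\<sigma> i) else 0)"
  define X where "X = conj_diag U g * A"
  have "X * mat_adjoint X = conj_diag U g * (A * mat_adjoint A) * conj_diag U g"
    by (simp add: X_def mult_assoc_mat_dim)
  also have "\<dots> = conj_diag U (\<lambda>i. if i < k \<and> ?\<sigma> i \<noteq> 0 then 1 else 0)"
    unfolding N by (simp add: conj_diag_eq_iff[OF U] g_def power2_eq_square field_simps)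
  finally have XX: "X * mat_adjoint X = \<dots>" .
  show ?thesis
  proof
    show "X \<in> carrier_mat m n" by (rule carrier_matI) (simp_all add: X_def)
    show "X * mat_adjoint X * (X * mat_adjoint X) = X * mat_adjoint X"
      unfolding XX by (simp add: conj_diag_eq_iff[OF U])
    have "X * mat_adjoint A = conj_diag U (\<lambda>i. g i * (?\<sigma> i)\<^sup>2)"
      by (simp add: X_def mult_assoc_mat_dim N)
    also have "(\<lambda>i. g i * (?\<sigma> i)\<^sup>2) = (\<lambda>i. if i < k then ?\<sigma> i else 0)"
      by (intro ext) (simp add: g_def power2_eq_square field_simps)
    finally have "mat_trace (X * mat_adjoint A) = complex_of_real (\<Sum>i<m. if i < k then ?\<sigma> i else 0)"
      by (simp only: mat_trace_conj_diag[OF U])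
    also have "(\<Sum>i<m. if i < k then ?\<sigma> i else 0) = ky_fan_norm k A"
      unfolding ky_fan_norm_eq_sum using k by (intro sum.mono_neutral_cong_right) auto
    finally show "mat_trace (X * mat_adjoint A) = complex_of_real (ky_fan_norm k A)" .
    have "complex_of_real (frob X) = complex_of_real (\<Sum>i<m. if i < k \<and> ?\<sigma> i \<noteq> 0 then 1 else 0)"
      unfolding mat_trace_mult_adjoint[symmetric] XX by (rule mat_trace_conj_diag[OF U])
    hence "frob X = (\<Sum>i<m. if i < k \<and> ?\<sigma> i \<noteq> 0 then 1 else 0)" unfolding of_real_eq_iff .
    also have "\<dots> \<le> (\<Sum>i<m. if i < k then 1 else 0)" by (rule sum_mono) auto
    also have "\<dots> = (\<Sum>i<k. 1)" using k by (intro sum.mono_neutral_cong_right) auto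
    finally show "frob X \<le> real k" by simp
  qed
qed

section \<open>The all-ones matrix and equality\<close>

text \<open>
  \<open>X / c\<close> is a partial isometry, hence a contraction; the two nonnegative quantities
  \<open>\<parallel>X X\<^sup>* K - c\<^sup>2 K\<parallel>\<close> and \<open>\<parallel>X\<^sup>* K - \<tau> J\<^sup>*\<parallel>\<close> give both the bound and what equality means.
\<close>
lemma partial_isometry_ones:
  fixes X :: "complex mat"
  assumes X: "X \<in> carrier_mat m n" and mn: "m > 0" "n > 0" and c: "c > 0"
    and sq: "X * mat_adjoint X * (X * mat_adjoint X) = complex_of_real (c\<^sup>2) \<cdot>\<^sub>m (X * mat_adjoint X)"
  defines "s \<equiv> sqrt (real m * real n)" and "x \<equiv> Re (mat_trace (X * ones_mat n m))"
  shows "x \<le> c * s"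
    and "x = c * s \<Longrightarrow> mat_adjoint X * ones_mat m m = complex_of_real (c * s / real n) \<cdot>\<^sub>m ones_mat n m"
    and "x = c * s \<Longrightarrow> X * mat_adjoint X * ones_mat m m = complex_of_real (c\<^sup>2) \<cdot>\<^sub>m ones_mat m m"
proof -
  note [simp] = carrier_matD[OF X]
  define Q where "Q = X * mat_adjoint X"
  define K where "K = ones_mat m m"
  \<comment> \<open>With j the all-ones vector of length \<open>m\<close>, the columns of
    \<open>K\<close> are \<open>m\<close> copies of j, so \<open>f\<close> is |X* j|^2.\<close>
  define f where "f = frob (mat_adjoint X * K) / real m"
  \<comment> \<open>In the case of equality X* j is a multiple of the all-ones vector of length
    \<open>n\<close>, with squared length c^2 m; this determines the factor.\<close>
  define \<tau> where "\<tau> = c * s / real n"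
  have s: "s > 0" "s * s = real m * real n" using mn by (auto simp: s_def)
  have dims [simp]: "dim_row Q = m" "dim_col Q = m" "dim_row K = m" "dim_col K = m"
    by (simp_all add: Q_def K_def)
  have adj: "mat_adjoint Q = Q" "mat_adjoint K = K" by (simp_all add: Q_def K_def)
  have KK: "K * K = of_nat m \<cdot>\<^sub>m K" by (simp add: K_def)
  have QQ: "Q * Q = complex_of_real (c\<^sup>2) \<cdot>\<^sub>m Q" using sq by (simp add: Q_def)
  have "complex_of_real (frob (mat_adjoint X * K)) = mat_trace (mat_adjoint X * (K * K) * X)"
    by (simp add: mult_assoc_mat_dim adj flip: mat_trace_mult_adjoint)
  also have "\<dots> = of_nat m * mat_trace (mat_adjoint X * K * X)"
    by (simp add: KK)
  also have "mat_trace (mat_adjoint X * K * X) = mat_trace (Q * K)"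
    by (subst mat_trace_comm) (simp_all add: Q_def mult_assoc_mat_dim)
  finally have tQK: "mat_trace (Q * K) = complex_of_real f"
    using mn by (simp add: f_def field_simps)
  have fX: "frob (mat_adjoint X * K) = real m * f" using mn by (simp add: f_def)
  have "complex_of_real (frob (Q * K)) = mat_trace (Q * (K * K) * Q)"
    by (simp add: mult_assoc_mat_dim adj flip: mat_trace_mult_adjoint)
  also have "\<dots> = of_nat m * mat_trace (Q * K * Q)" by (simp add: KK)
  also have "mat_trace (Q * K * Q) = mat_trace (Q * Q * K)"
    by (subst mat_trace_comm) (simp_all add: mult_assoc_mat_dim)
  also have "\<dots> = complex_of_real (c\<^sup>2) * complex_of_real f" by (simp add: QQ tQK del: of_real_power)
  finally have "complex_of_real (frob (Q * K)) = complex_of_real (real m * (c\<^sup>2 * f))" by simp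
  hence fQ: "frob (Q * K) = real m * (c\<^sup>2 * f)" unfolding of_real_eq_iff .
  have "mat_trace (Q * K * mat_adjoint K) = of_nat m * complex_of_real f"
    by (simp add: adj mult_assoc_mat_dim KK tQK)
  moreover have fK: "frob K = real m * real m" by (simp add: K_def)
  \<comment> \<open>\<open>Q\<close> is c^2 times an orthogonal projection. Nonnegativity here gives
    |X* j|^2 <= c^2 m, and equality means that j lies in its range.\<close>
  ultimately have 1: "frob (Q * K - complex_of_real (c\<^sup>2) \<cdot>\<^sub>m K) = real m * c\<^sup>2 * (c\<^sup>2 * real m - f)"
    by (subst frob_diff_smult[of _ m m])
       (auto simp: fQ fK adj power2_eq_square algebra_simps intro!: carrier_matI)
  have "real m * c\<^sup>2 > 0" using c mn by simp
  hence f_le: "f \<le> c\<^sup>2 * real m"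
    using frob_nonneg[of "Q * K - complex_of_real (c\<^sup>2) \<cdot>\<^sub>m K"] unfolding 1
    by (simp only: zero_le_mult_iff) linarith
  have "mat_trace (mat_adjoint X * K * mat_adjoint (ones_mat n m)) = of_nat m * mat_trace (mat_adjoint X * ones_mat m n)"
    by (simp add: mult_assoc_mat_dim K_def)
  also have "mat_trace (mat_adjoint X * ones_mat m n) = cnj (mat_trace (ones_mat n m * X))"
    by (subst mat_trace_adjoint[symmetric]) simp_all
  also have "mat_trace (ones_mat n m * X) = mat_trace (X * ones_mat n m)"
    by (rule mat_trace_comm) simp_all
  finally have "Re (mat_trace (mat_adjoint X * K * mat_adjoint (ones_mat n m))) = real m * x"
    by (simp add: x_def)
  \<comment> \<open>Nonnegativity gives 2 \<tau> x <= f + \<tau>^2 n, and both terms on the right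
    are at most c^2 m.\<close>
  hence 2: "frob (mat_adjoint X * K - complex_of_real \<tau> \<cdot>\<^sub>m ones_mat n m) =
      real m * (f - 2 * \<tau> * x + \<tau> * (\<tau> * real n))"
    by (subst frob_diff_smult[of _ n m])
       (auto simp: fX power2_eq_square algebra_simps intro!: carrier_matI)
  have \<tau>n: "\<tau> * real n = c * s" using mn by (simp add: \<tau>_def)
  have \<tau>s: "\<tau> * s = c * real m"
    using mn by (simp add: \<tau>_def mult.assoc s(2))
  have \<tau>: "\<tau> > 0" using c s mn by (simp add: \<tau>_def)
  have \<tau>2: "\<tau> * (\<tau> * real n) = c\<^sup>2 * real m"
    by (metis \<tau>n \<tau>s mult.left_commute mult.assoc power2_eq_square)
  have "0 \<le> f - 2 * \<tau> * x + \<tau> * (\<tau> * real n)"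
    using frob_nonneg[of "mat_adjoint X * K - complex_of_real \<tau> \<cdot>\<^sub>m ones_mat n m"] mn unfolding 2
    by (simp add: zero_le_mult_iff)
  hence "\<tau> * x \<le> c\<^sup>2 * real m" using f_le unfolding \<tau>2 by linarith
  also have "c\<^sup>2 * real m = \<tau> * (c * s)" using \<tau>s by (simp add: power2_eq_square)
  finally show "x \<le> c * s" using \<tau> by simp
  assume eq: "x = c * s"
  have "\<tau> * x = c\<^sup>2 * real m" unfolding eq using \<tau>s by (simp add: power2_eq_square)
  \<comment> \<open>At equality the bracket in \<open>2\<close> becomes
    \<open>f - c\<^sup>2 * real m\<close>, which is both nonnegative and nonpositive; so the norms
    in \<open>1\<close> and \<open>2\<close> both vanish.\<close>
  hence *: "f - 2 * \<tau> * x + \<tau> * (\<tau> * real n) = f - c\<^sup>2 * real m" unfolding \<tau>2 by linarith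
  hence feq: "f = c\<^sup>2 * real m"
    using frob_nonneg[of "mat_adjoint X * K - complex_of_real \<tau> \<cdot>\<^sub>m ones_mat n m"] mn f_le unfolding 2 *
    by (simp add: zero_le_mult_iff)
  have "mat_adjoint X * K = complex_of_real \<tau> \<cdot>\<^sub>m ones_mat n m"
    by (rule frob_diff_smult_eq_0[of _ n m], unfold 2 *) (auto simp: feq intro!: carrier_matI)
  thus "mat_adjoint X * ones_mat m m = complex_of_real (c * s / real n) \<cdot>\<^sub>m ones_mat n m"
    by (simp add: K_def \<tau>_def)
  have "Q * K = complex_of_real (c\<^sup>2) \<cdot>\<^sub>m K"
    by (rule frob_diff_smult_eq_0[of _ m m], unfold 1) (auto simp: feq intro!: carrier_matI)
  thus "X * mat_adjoint X * ones_mat m m = complex_of_real (c\<^sup>2) \<cdot>\<^sub>m ones_mat m m"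
    by (simp add: K_def Q_def)
qed

text \<open>The inner product in \<open>plain\<close> is the sum of all entries; as a trace it fits
  the Frobenius estimates.\<close>

lemma plain_iff_trace:
  assumes "B \<in> carrier_mat m n"
  shows "plain B \<longleftrightarrow> complex_of_real (singular_value B 1) =
           mat_trace (B * ones_mat n m) / complex_of_real (sqrt (real m * real n))"
proof -
  have "(B *\<^sub>v ones_vec n) \<bullet>c ones_vec m = (\<Sum>i<m. \<Sum>j<n. B $$ (i, j))"
    using assms by (auto simp: scalar_prod_def ones_vec_def atLeast0LessThan intro!: sum.cong)
  also have "\<dots> = mat_trace (B * ones_mat n m)"
    using assms by (subst mat_trace_mult_index) auto
  finally show ?thesis using assms by (simp add: plain_def)
qed

text \<open>
  With \<open>K\<close> the all-ones \<open>m \<times> m\<close> matrix, \<open>4 A A\<^sup>* = B B\<^sup>* + w K\<close> where \<open>B B\<^sup>* K = c\<^sup>2 K\<close>. Hence \<open>K\<close> is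
  a polynomial in \<open>4 A A\<^sup>*\<close>, is diagonalized along with it, and singles out the eigenvalue
  \<open>(c + s)\<^sup>2\<close>; the others are \<open>c\<^sup>2\<close> or \<open>0\<close>.
\<close>
lemma ky_fan_norm_half_plus_ones:
  assumes B: "B \<in> carrier_mat m n" and A: "A \<in> carrier_mat m n"
    and AB: "2 \<cdot>\<^sub>m A = B + ones_mat m n"
    and mn: "m > 0" "n > 0" and c: "c > 0"
    and sq: "B * mat_adjoint B * (B * mat_adjoint B) = complex_of_real (c\<^sup>2) \<cdot>\<^sub>m (B * mat_adjoint B)"
    and tr: "mat_trace (B * ones_mat n m) = complex_of_real (c * sqrt (real m * real n))"
    and fB: "frob B = real k * c\<^sup>2"
  shows "ky_fan_norm k A = (real k * c + sqrt (real m * real n)) / 2"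
proof -
  note [simp] = carrier_matD[OF A] carrier_matD[OF B]
  define s where "s = sqrt (real m * real n)"
  have s: "s > 0" "s * s = real m * real n" using mn by (auto simp: s_def)
  define Q where "Q = B * mat_adjoint B"
  define K where "K = ones_mat m m"
  define J where "J = ones_mat m n"
  have dims [simp]: "dim_row Q = m" "dim_col Q = m" "dim_row K = m" "dim_col K = m"
    "dim_row J = m" "dim_col J = n"
    by (simp_all add: Q_def K_def J_def)
  have adj: "mat_adjoint Q = Q" "mat_adjoint K = K" by (simp_all add: Q_def K_def)
  have KK: "K * K = complex_of_real (real m) \<cdot>\<^sub>m K" by (simp add: K_def)
  have QQ: "Q * Q = complex_of_real (c\<^sup>2) \<cdot>\<^sub>m Q" using sq by (simp add: Q_def)
  have x: "Re (mat_trace (B * ones_mat n m)) = c * sqrt (real m * real n)" by (simp add: tr)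
  \<comment> \<open>The trace hypothesis is the equality case for \<open>B\<close> itself.\<close>
  note eqs = partial_isometry_ones(2,3)[OF B mn c sq x, folded s_def Q_def K_def]
  have QK: "Q * K = complex_of_real (c\<^sup>2) \<cdot>\<^sub>m K" by (rule eqs(2))
  have KQ: "K * Q = complex_of_real (c\<^sup>2) \<cdot>\<^sub>m K"
    using arg_cong[OF QK, of mat_adjoint] by (simp add: adj)
  \<comment> \<open>Both values of B B* K are compared and the factor c s / n is cancelled, which
    yields the cross term B J*.\<close>
  have "complex_of_real (c * s / real n) \<cdot>\<^sub>m (B * mat_adjoint J) = B * (mat_adjoint B * K)"
    unfolding eqs(1) J_def by simp
  also have "\<dots> = complex_of_real (c\<^sup>2) \<cdot>\<^sub>m K"
    using QK by (simp add: Q_def mult_assoc_mat_dim)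
  finally have "complex_of_real (real n / (c * s)) \<cdot>\<^sub>m (complex_of_real (c * s / real n) \<cdot>\<^sub>m (B * mat_adjoint J))
      = complex_of_real (real n / (c * s)) \<cdot>\<^sub>m (complex_of_real (c\<^sup>2) \<cdot>\<^sub>m K)" by simp
  hence BJ: "B * mat_adjoint J = complex_of_real (c * real n / s) \<cdot>\<^sub>m K"
    unfolding smult_smult_mat of_real_mult[symmetric]
    using c s mn by (simp add: power2_eq_square mult_ac)
  have JB: "J * mat_adjoint B = complex_of_real (c * real n / s) \<cdot>\<^sub>m K"
    using arg_cong[OF BJ, of mat_adjoint] by (simp add: adj)
  \<comment> \<open>Each of the two cross terms contributes c n / s, and J J* contributes n.\<close>
  define w where "w = 2 * c * real n / s + real n"
  define N where "N = 4 \<cdot>\<^sub>m (A * mat_adjoint A)"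
  have "N = (2 \<cdot>\<^sub>m A) * mat_adjoint (2 \<cdot>\<^sub>m A)" by (simp add: N_def)
  also have "\<dots> = Q + J * mat_adjoint B + (B * mat_adjoint J + J * mat_adjoint J)"
    unfolding AB J_def[symmetric]
    by (simp add: Q_def add_mult_distrib_mat[of _ m n _ _ m] mult_add_distrib_mat[of _ m n _ m] carrier_matI)
  also have "\<dots> = Q + complex_of_real w \<cdot>\<^sub>m K"
    unfolding BJ JB by (rule eq_matI) (auto simp: J_def K_def w_def)
  finally have N: "N = Q + complex_of_real w \<cdot>\<^sub>m K" .
  define a where "a = (c + s)\<^sup>2"
  have wm: "w * real m = 2 * c * s + s * s"
    using s mn by (simp add: w_def field_simps)
  have a: "a = c\<^sup>2 + w * real m" unfolding wm by (simp add: a_def power2_eq_square algebra_simps)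
  have w: "w > 0" using c s mn by (auto simp: w_def intro!: add_pos_pos)
  have apos: "a > 0" using c s by (simp add: a_def)
  have NK: "N * K = complex_of_real a \<cdot>\<^sub>m K"
    unfolding N a
    by (simp add: add_mult_distrib_mat[of _ m m _ _ m] carrier_matI QK KK)
       (rule eq_matI, auto simp: algebra_simps)
  have NQ: "N * Q = complex_of_real (c\<^sup>2) \<cdot>\<^sub>m N"
    unfolding N
    by (simp add: add_mult_distrib_mat[of _ m m _ _ m] carrier_matI QQ KQ)
       (rule eq_matI, auto simp: algebra_simps)
  have "N * N = N * (Q + complex_of_real w \<cdot>\<^sub>m K)" by (simp flip: N)
  also have "\<dots> = N * Q + complex_of_real w \<cdot>\<^sub>m (N * K)"
    by (simp add: mult_add_distrib_mat[of _ m m _ m] carrier_matI N)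
  finally have NN: "N * N = complex_of_real (c\<^sup>2) \<cdot>\<^sub>m N + complex_of_real (w * a) \<cdot>\<^sub>m K"
    unfolding NQ NK by simp
  obtain U where U: "unitary_mat m U" and AA: "A * mat_adjoint A = conj_diag U (\<lambda>i. (singular_values A ! i)\<^sup>2)"
    by (rule gram_diagonalization[OF A])
  note [simp] = conj_diag_dim[OF U] conj_diag_mult[OF U]
  define \<sigma> where "\<sigma> = (\<lambda>i. 2 * singular_values A ! i)"
  define d where "d = (\<lambda>i. (\<sigma> i)\<^sup>2)"
  \<comment> \<open>The formula for \<open>N * N\<close> below \<open>NQ\<close> and
    \<open>NK\<close> is solved for \<open>K\<close>; \<open>e i\<close> is the eigenvalue of
    \<open>K\<close> on the eigenvector where \<open>N\<close> has \<open>d i\<close>.\<close>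
  define e where "e = (\<lambda>i. (d i * d i - c\<^sup>2 * d i) / (w * a))"
  have Nd: "N = conj_diag U d"
    using conj_diag_smult[OF U, of 4] unfolding N_def AA d_def \<sigma>_def
    by (simp add: power_mult_distrib)
  have "K = complex_of_real (1 / (w * a)) \<cdot>\<^sub>m (N * N + complex_of_real (- c\<^sup>2) \<cdot>\<^sub>m N)"
    unfolding NN using w apos by (intro eq_matI) (auto simp: N)
  also have "\<dots> = conj_diag U e"
    unfolding Nd by (simp add: conj_diag_smult[OF U] conj_diag_add[OF U] conj_diag_eq_iff[OF U] e_def del: of_real_minus of_real_divide of_real_power of_real_mult)
  finally have Kd: "K = conj_diag U e" .
  \<comment> \<open>From N K = a K and K K = m K each \<open>e i\<close> is 0 or \<open>m\<close>,
    and a nonzero one forces \<open>d i = a\<close>.\<close>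
  have de: "d i * e i = a * e i" if "i < m" for i
    using NK that unfolding Nd Kd by (simp add: conj_diag_smult[OF U] conj_diag_eq_iff[OF U])
  have ee: "e i * e i = real m * e i" if "i < m" for i
    using KK that unfolding Kd conj_diag_smult[OF U] by (simp add: conj_diag_eq_iff[OF U])
  have "mat_trace K = of_nat m" by (simp add: K_def)
  hence "complex_of_real (\<Sum>i<m. e i) = complex_of_real (real m)"
    unfolding Kd mat_trace_conj_diag[OF U] by simp
  hence sum_e: "(\<Sum>i<m. e i) = real m" unfolding of_real_eq_iff .
  have "mat_trace N = complex_of_real (frob B) + complex_of_real w * of_nat m"
    unfolding N by (simp add: mat_trace_mult_adjoint Q_def K_def)
  hence "complex_of_real (\<Sum>i<m. d i) = complex_of_real (real k * c\<^sup>2 + w * real m)"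
    unfolding Nd mat_trace_conj_diag[OF U] fB by simp
  hence sum_d: "(\<Sum>i<m. d i) = real k * c\<^sup>2 + w * real m" unfolding of_real_eq_iff .
  have \<sigma>: "\<sigma> i \<ge> 0" if "i < m" for i
    using singular_value_nonneg[of i A] that by (simp add: \<sigma>_def)
  have cases: "e i = 0 \<and> \<sigma> i = 0 \<or> e i = 0 \<and> \<sigma> i = c \<or> e i = real m \<and> \<sigma> i = c + s" if i: "i < m" for i
  proof (cases "e i = 0")
    case True
    hence "d i * d i = c\<^sup>2 * d i" using w apos by (simp add: e_def)
    hence "d i = 0 \<or> d i = c\<^sup>2" by simp
    thus ?thesis using True \<sigma>[OF i] c by (auto simp: d_def power2_eq_iff_nonneg)
  next
    case False
    hence "e i = real m" "d i = a" using ee[OF i] de[OF i] by auto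
    thus ?thesis using \<sigma>[OF i] c s by (auto simp: d_def a_def power2_eq_iff_nonneg)
  qed
  \<comment> \<open>On the three possible pairs, \<sigma> is a linear combination of
    \<open>d\<close> and \<open>e\<close>. Its sum therefore follows from the traces of
    \<open>N\<close> and \<open>K\<close>, without locating the exceptional eigenvalue.\<close>
  have "\<sigma> i = d i / c + (c + s - a / c) / real m * e i" if "i < m" for i
    using cases[OF that] c mn unfolding d_def a_def by (auto simp: power2_eq_square)
  hence "(\<Sum>i<m. \<sigma> i) = (\<Sum>i<m. d i / c + (c + s - a / c) / real m * e i)" by (intro sum.cong) auto
  also have "\<dots> = (\<Sum>i<m. d i) / c + (c + s - a / c) / real m * (\<Sum>i<m. e i)"
    by (simp add: sum.distrib sum_divide_distrib sum_distrib_left)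
  also have "\<dots> = real k * c + s"
    unfolding sum_e sum_d a using c mn by (simp add: field_simps power2_eq_square)
  finally have sum_\<sigma>: "(\<Sum>i<m. \<sigma> i) = real k * c + s" .
  \<comment> \<open>The same interpolation counts the nonzero values: there are \<open>k\<close>, so
    the Ky Fan norm is the full sum.\<close>
  have "of_bool (\<sigma> i \<noteq> 0) = d i / c\<^sup>2 + (1 - a / c\<^sup>2) / real m * e i" if "i < m" for i
    using cases[OF that] c mn s unfolding d_def a_def by (auto simp: power2_eq_square)
  hence "(\<Sum>i<m. of_bool (\<sigma> i \<noteq> 0)) = (\<Sum>i<m. d i / c\<^sup>2 + (1 - a / c\<^sup>2) / real m * e i)"
    by (intro sum.cong) auto
  also have "\<dots> = (\<Sum>i<m. d i) / c\<^sup>2 + (1 - a / c\<^sup>2) / real m * (\<Sum>i<m. e i)"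
    by (simp add: sum.distrib sum_divide_distrib sum_distrib_left)
  also have "\<dots> = real k"
    unfolding sum_e sum_d a using c mn by (simp add: field_simps power2_eq_square)
  finally have "real (card {i. i < m \<and> \<sigma> i \<noteq> 0}) = real k"
    by (simp add: sum.If_cases of_bool_def Int_def)
  hence "card {i. i < dim_row A \<and> singular_values A ! i \<noteq> 0} = k" by (simp add: \<sigma>_def)
  from ky_fan_norm_eq_sum_all[OF this] have "2 * ky_fan_norm k A = (\<Sum>i<m. \<sigma> i)"
    by (simp add: \<sigma>_def sum_distrib_left)
  thus ?thesis unfolding sum_\<sigma> s_def by simp
qed

section \<open>The equality conditions as identities for the Gram matrix\<close>

lemma hadamard_mat_iff_gram:
  assumes B: "B \<in> carrier_mat n n" and elem: "elements_mat B \<subseteq> {-1, 1}"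
  shows "hadamard_mat B \<longleftrightarrow> B * mat_adjoint B = of_nat n \<cdot>\<^sub>m 1\<^sub>m n"
proof -
  have ent: "B $$ (i, j) = -1 \<or> B $$ (i, j) = 1" if "i < n" "j < n" for i j
    using elem elements_matI[OF B that refl] by auto
  have gram: "(B * mat_adjoint B) $$ (i, j) = row B i \<bullet>c row B j" if "i < n" "j < n" for i j
    using B that by (auto simp: scalar_prod_def intro!: sum.cong)
  \<comment> \<open>Entries of modulus one fix the diagonal of the Gram matrix, so only the
    off-diagonal entries express orthogonality.\<close>
  have diag: "row B i \<bullet>c row B i = of_nat n" if "i < n" for i
  proof -
    have "row B i \<bullet>c row B i = (\<Sum>j<n. B $$ (i, j) * cnj (B $$ (i, j)))"
      using B that by (simp add: scalar_prod_def atLeast0LessThan)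
    also have "\<dots> = (\<Sum>j<n. 1)"
      using ent[OF that] by (intro sum.cong) fastforce+
    finally show ?thesis by simp
  qed
  show ?thesis
  proof
    assume "hadamard_mat B"
    thus "B * mat_adjoint B = of_nat n \<cdot>\<^sub>m 1\<^sub>m n"
      using B by (intro eq_matI) (auto simp: gram diag hadamard_mat_def simp del: index_mult_mat(1))
  next
    assume *: "B * mat_adjoint B = of_nat n \<cdot>\<^sub>m 1\<^sub>m n"
    have "row B i \<bullet>c row B j = 0" if "i < n" "j < n" "i \<noteq> j" for i j
      using gram[OF that(1,2)] that unfolding * by simp
    thus "hadamard_mat B" using B elem by (auto simp: hadamard_mat_def)
  qed
qed

text \<open>With the Frobenius norm known, this ties the number of nonzero singular values to their
  common size.\<close>

lemma frob_eq_card_nonzero_singular_values: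
  assumes B: "B \<in> carrier_mat m n"
    and sv: "\<And>i. i < m \<Longrightarrow> singular_values B ! i = 0 \<or> singular_values B ! i = c"
  shows "frob B = real (card {i. i < dim_row B \<and> singular_values B ! i \<noteq> 0}) * c\<^sup>2"
proof -
  let ?S = "{i. i < dim_row B \<and> singular_values B ! i \<noteq> 0}"
  have "frob B = (\<Sum>i\<in>?S. c\<^sup>2)"
    unfolding frob_eq_sum_singular_values[OF B] using B sv
    by (intro sum.mono_neutral_cong_right) fastforce+
  thus ?thesis by simp
qed

text \<open>The squared Frobenius norm m n is shared by \<open>k\<close> equal squares, so the
  common value must be \<open>c\<close>; conversely the value \<open>c\<close> forces the count
  \<open>k\<close>. Plainness then fixes the trace as \<open>c * s\<close>.\<close>

lemma plain_equal_singular_values_iff: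
  assumes B: "B \<in> carrier_mat m n" and frob: "frob B = real m * real n"
    and k: "1 \<le> k" "k \<le> m" and n: "n > 0"
  defines "s \<equiv> sqrt (real m * real n)" and "c \<equiv> sqrt (real m * real n) / sqrt (real k)"
  shows "plain B \<and> exactly_nonzero_singular_values k B \<and> nonzero_singular_values_equal B \<longleftrightarrow>
         B * mat_adjoint B * (B * mat_adjoint B) = complex_of_real (c\<^sup>2) \<cdot>\<^sub>m (B * mat_adjoint B) \<and>
         mat_trace (B * ones_mat n m) = complex_of_real (c * s)"
    (is "?L \<longleftrightarrow> ?R")
proof -
  let ?sv = "singular_values B" and ?S = "{i. i < dim_row B \<and> singular_values B ! i \<noteq> 0}"
  have dim: "dim_row B = m" using B by simp
  have s: "s > 0" and c: "c > 0" using k n by (auto simp: s_def c_def)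
  have kc: "real k * c\<^sup>2 = real m * real n" using k by (simp add: c_def power_divide)
  have plain: "plain B \<longleftrightarrow> mat_trace (B * ones_mat n m) = complex_of_real (?sv ! 0 * s)"
    unfolding plain_iff_trace[OF B] s_def[symmetric] using s
    by (auto simp: singular_value_def field_simps)
  \<comment> \<open>As \<open>k\<close> is positive some singular value is nonzero, hence so is the
    largest one, the one that \<open>plain\<close> refers to.\<close>
  have first: "?sv ! 0 \<noteq> 0" if "card ?S = k"
  proof -
    have "?S \<noteq> {}"
    proof
      assume "?S = {}"
      with that k show False by (simp only: card.empty)
    qed
    then obtain i where "i < m" "?sv ! i \<noteq> 0" using dim by auto
    thus ?thesis using singular_values_antimono[of 0 i B] singular_value_nonneg[of i B] dim by auto
  qed
  note sq = gram_square_iff_singular_values[OF B less_imp_le[OF c]]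
  show ?thesis
  proof
    assume R: ?R
    hence sv: "?sv ! i = 0 \<or> ?sv ! i = c" if "i < m" for i using sq that by blast
    have "real (card ?S) * c\<^sup>2 = real k * c\<^sup>2"
      using frob_eq_card_nonzero_singular_values[OF B sv] frob kc by metis
    hence card: "card ?S = k" using c by auto
    hence "?sv ! 0 = c" using first sv[of 0] k by auto
    moreover have "nonzero_singular_values_equal B"
      unfolding nonzero_singular_values_equal_def
    proof (intro ballI impI)
      fix i j assume "i \<in> {1..dim_row B}" "j \<in> {1..dim_row B}"
        "singular_value B i \<noteq> 0" "singular_value B j \<noteq> 0"
      thus "singular_value B i = singular_value B j"
        using sv[of "i - 1"] sv[of "j - 1"] dim by (auto simp: singular_value_def)
    qed
    ultimately show ?L using R card by (simp add: plain card_nonzero_singular_values)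
  next
    assume L: ?L
    hence card: "card ?S = k" by (simp add: card_nonzero_singular_values)
    have sv: "?sv ! i = 0 \<or> ?sv ! i = ?sv ! 0" if "i < m" for i
    proof -
      have "Suc i \<in> {1..dim_row B}" "1 \<in> {1..dim_row B}" using that dim by auto
      thus ?thesis using L first[OF card]
        unfolding nonzero_singular_values_equal_def by (force simp: singular_value_def)
    qed
    have "real k * (?sv ! 0)\<^sup>2 = real k * c\<^sup>2"
      using frob_eq_card_nonzero_singular_values[OF B sv] frob kc card by metis
    hence "?sv ! 0 = c"
      using k c singular_value_nonneg[of 0 B] dim by (simp add: power2_eq_iff_nonneg)
    thus ?R using L sv sq by (simp add: plain)
  qed
qed

section \<open>The bound, its equality case and the Hadamard case\<close>

lemma ky_fan_norm_zero_one_mat: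
  assumes A: "A \<in> carrier_mat m n" and B: "B \<in> carrier_mat m n"
    and BA: "B = 2 \<cdot>\<^sub>m A - ones_mat m n" and frob: "frob B = real m * real n"
    and im: "\<And>i j. i < m \<Longrightarrow> j < n \<Longrightarrow> Im (B $$ (i, j)) = 0"
    and k: "1 \<le> k" "k \<le> m" and n: "n > 0"
  defines "s \<equiv> sqrt (real m * real n)" and "c \<equiv> sqrt (real m * real n) / sqrt (real k)"
  shows "ky_fan_norm k A \<le> 1 / 2 * (1 + sqrt (real k)) * s" (is ?bound)
    and "ky_fan_norm k A = 1 / 2 * (1 + sqrt (real k)) * s \<longleftrightarrow>
         B * mat_adjoint B * (B * mat_adjoint B) = complex_of_real (c\<^sup>2) \<cdot>\<^sub>m (B * mat_adjoint B) \<and>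
         mat_trace (B * ones_mat n m) = complex_of_real (c * s)" (is "?eq \<longleftrightarrow> ?R")
proof -
  note [simp] = carrier_matD[OF A] carrier_matD[OF B]
  have m: "m > 0" using k by simp
  have s: "s > 0" and c: "c > 0" using k n by (auto simp: s_def c_def)
  have kc: "real k * c\<^sup>2 = real m * real n" using k by (simp add: c_def power_divide)
  have kc': "real k * c = sqrt (real k) * s"
  proof -
    have "sqrt (real k) * c = s" using k by (simp add: c_def s_def)
    thus ?thesis by (metis mult.assoc of_nat_0_le_iff real_sqrt_mult_self abs_of_nonneg)
  qed
  obtain X where X: "X \<in> carrier_mat m n"
    and XX: "X * mat_adjoint X * (X * mat_adjoint X) = X * mat_adjoint X"
    and XA: "mat_trace (X * mat_adjoint A) = complex_of_real (ky_fan_norm k A)"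
    and fX: "frob X \<le> real k"
    by (rule ky_fan_norm_partial_isometry[OF A k(2)])
  note [simp] = carrier_matD[OF X]
  define x where "x = Re (mat_trace (X * ones_mat n m))"
  define y where "y = Re (mat_trace (B * mat_adjoint X))"
  have x: "x \<le> s" using partial_isometry_ones(1)[OF X m n, of 1] XX by (simp add: x_def s_def)
  have "mat_trace (X * mat_adjoint B) = 2 * mat_trace (X * mat_adjoint A) - mat_trace (X * ones_mat n m)"
    by (simp add: mat_trace_mult_index BA sum_subtractf sum_distrib_left algebra_simps)
  moreover have "mat_trace (X * mat_adjoint B) = cnj (mat_trace (B * mat_adjoint X))"
    by (subst mat_trace_adjoint[symmetric]) simp_all
  ultimately have xy: "2 * ky_fan_norm k A = x + y" unfolding XA x_def y_def
    by (metis (no_types, lifting) Re_complex_of_real cnj.sel(1) diff_add_cancel add.commute minus_complex.sel(1) of_real_mult of_real_numeral)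
  have f: "frob (B - complex_of_real c \<cdot>\<^sub>m X) = real m * real n - 2 * c * y + c\<^sup>2 * frob X"
    by (simp add: frob_diff_smult[OF B X] frob y_def)
  have "c\<^sup>2 * frob X \<le> real m * real n"
    using mult_left_mono[OF fX, of "c\<^sup>2"] kc by (simp add: mult.commute)
  \<comment> \<open>Both m n and c^2 |X|^2 are at most k c^2, the first with equality.\<close>
  hence f_le: "frob (B - complex_of_real c \<cdot>\<^sub>m X) \<le> 2 * c * (real k * c - y)"
    unfolding f using kc by (simp add: algebra_simps power2_eq_square)
  have "0 \<le> 2 * c * (real k * c - y)"
    using frob_nonneg f_le by (rule order_trans)
  hence y: "y \<le> sqrt (real k) * s" using c kc' by (simp add: zero_le_mult_iff)
  have half: "1 / 2 * (1 + sqrt (real k)) * s = (s + sqrt (real k) * s) / 2" by (simp add: algebra_simps)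
  define q where "q = sqrt (real k) * s"
  have yq: "y \<le> q" using y by (simp add: q_def)
  have bound: "ky_fan_norm k A \<le> (s + q) / 2"
    using x yq xy by (simp add: field_simps)
  have bound_eq: "x = s \<and> y = q" if "ky_fan_norm k A = (s + q) / 2"
    using x yq xy that by (simp add: field_simps)
  show ?bound using bound unfolding half q_def .
  show "?eq \<longleftrightarrow> ?R"
  proof
    assume ?eq
    hence eq: "x = s" "y = real k * c" using bound_eq kc' unfolding half q_def by auto
    have "frob (B - complex_of_real c \<cdot>\<^sub>m X) = 0"
      using f_le frob_nonneg[of "B - complex_of_real c \<cdot>\<^sub>m X"] unfolding eq by simp
    hence BX: "B = complex_of_real c \<cdot>\<^sub>m X" by (rule frob_diff_smult_eq_0[OF B X])
    have gram: "B * mat_adjoint B = complex_of_real (c\<^sup>2) \<cdot>\<^sub>m (X * mat_adjoint X)"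
      by (simp add: BX power2_eq_square)
    \<comment> \<open>The value of \<open>x\<close> fixes only the real part of the trace; the
      entries of \<open>B\<close> being real settles the rest.\<close>
    have "Im (mat_trace (B * ones_mat n m)) = 0"
      using im by (simp add: mat_trace_mult_index)
    moreover have "Re (mat_trace (B * ones_mat n m)) = c * s"
      using eq(1) by (simp add: BX x_def)
    ultimately have "mat_trace (B * ones_mat n m) = complex_of_real (c * s)" by (simp add: complex_eq_iff)
    thus ?R unfolding gram by (simp add: XX)
  next
    assume R: ?R
    have "2 \<cdot>\<^sub>m A = B + ones_mat m n" unfolding BA by (rule eq_matI) auto
    from ky_fan_norm_half_plus_ones[OF B A this m n c _ _ , of k] R frob kc
    have "ky_fan_norm k A = (real k * c + s) / 2" by (simp add: s_def)
    thus ?eq unfolding half kc' by simp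
  qed
qed

theorem theorem5:
  fixes A :: "complex mat" and m n k :: nat
  assumes "n \<ge> m" and "m \<ge> k" and "k \<ge> 1"
    and "A \<in> carrier_mat m n" and "zero_one_mat A"
  shows "ky_fan_norm k A \<le> 1 / 2 * (1 + sqrt (real k)) * sqrt (real m * real n)
    \<and> (ky_fan_norm k A = 1 / 2 * (1 + sqrt (real k)) * sqrt (real m * real n) \<longleftrightarrow>
         plain (2 \<cdot>\<^sub>m A - ones_mat m n)
         \<and> exactly_nonzero_singular_values k (2 \<cdot>\<^sub>m A - ones_mat m n)
         \<and> nonzero_singular_values_equal (2 \<cdot>\<^sub>m A - ones_mat m n))
    \<and> (m = n \<and> n = k \<longrightarrow>
         (ky_fan_norm k A = 1 / 2 * (1 + sqrt (real k)) * sqrt (real m * real n) \<longleftrightarrow>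
            plain (2 \<cdot>\<^sub>m A - ones_mat m m) \<and> hadamard_mat (2 \<cdot>\<^sub>m A - ones_mat m m)))"
proof -
  note A = assms(4) and k = assms(3,2)
  have n: "n > 0" using assms(1-3) by simp
  define B where "B = 2 \<cdot>\<^sub>m A - ones_mat m n"
  have B: "B \<in> carrier_mat m n" using A by (auto simp: B_def)
  have ent: "B $$ (i, j) = -1 \<or> B $$ (i, j) = 1" if "i < m" "j < n" for i j
    using assms(5) elements_matI[OF A that refl] A that by (auto simp: B_def zero_one_mat_def)
  have frob: "frob B = real m * real n"
  proof -
    have "frob B = (\<Sum>i<m. \<Sum>j<n. 1)"
      unfolding frob_def using B ent by (intro sum.cong) fastforce+
    thus ?thesis by simp
  qed
  have im: "Im (B $$ (i, j)) = 0" if "i < m" "j < n" for i j using ent[OF that] by auto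
  note main = ky_fan_norm_zero_one_mat[OF A B B_def frob im k n,
      folded plain_equal_singular_values_iff[OF B frob k n]]
  have "exactly_nonzero_singular_values k B \<and> nonzero_singular_values_equal B \<longleftrightarrow> hadamard_mat B"
    if mn: "m = n" "n = k"
  proof -
    have B': "B \<in> carrier_mat k k" using B mn by simp
    have sv: "singular_values B ! i \<ge> 0" if "i < k" for i
      using singular_value_nonneg[of i B] B' that by simp
    have elem: "elements_mat B \<subseteq> {-1, 1}"
    proof
      fix b assume "b \<in> elements_mat B"
      then obtain i j where "i < m" "j < n" "b = B $$ (i, j)" using B by (auto simp: elements_mat_def)
      thus "b \<in> {-1, 1}" using ent by blast
    qed
    \<comment> \<open>For m = n = k the Gram matrix is \<open>k\<close> times the identity exactly
      when all singular values are the root of \<open>k\<close>.\<close>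
    have "hadamard_mat B \<longleftrightarrow> (\<forall>i<k. singular_values B ! i = sqrt (real k))"
      using gram_scalar_iff_singular_values[OF B', of "sqrt (real k)"]
      by (simp add: hadamard_mat_iff_gram[OF B' elem])
    also have "\<dots> \<longleftrightarrow> exactly_nonzero_singular_values k B \<and> nonzero_singular_values_equal B"
    proof
      assume *: "\<forall>i<k. singular_values B ! i = sqrt (real k)"
      hence "{i. i < dim_row B \<and> singular_values B ! i \<noteq> 0} = {..<k}" using B' by auto
      moreover have "singular_value B i = sqrt (real k)" if "i \<in> {1..dim_row B}" for i
        using * that B' by (auto simp: singular_value_def)
      ultimately show "exactly_nonzero_singular_values k B \<and> nonzero_singular_values_equal B"
        by (simp add: card_nonzero_singular_values nonzero_singular_values_equal_def)
    next
      assume *: "exactly_nonzero_singular_values k B \<and> nonzero_singular_values_equal B"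
      hence "card {i. i < k \<and> singular_values B ! i \<noteq> 0} = card {..<k}"
        using B' by (simp add: card_nonzero_singular_values)
      hence "{i. i < k \<and> singular_values B ! i \<noteq> 0} = {..<k}" by (intro card_subset_eq) auto
      hence nz: "singular_values B ! i \<noteq> 0" if "i < k" for i using that by blast
      have eq: "singular_values B ! i = singular_values B ! 0" if "i < k" for i
      proof -
        have "Suc i \<in> {1..dim_row B}" "1 \<in> {1..dim_row B}" using that B' by auto
        thus ?thesis using * nz[OF that] nz[of 0] that
          unfolding nonzero_singular_values_equal_def by (force simp: singular_value_def)
      qed
      \<comment> \<open>The \<open>k\<close> equal squares add up to k^2, so each of them is
        \<open>k\<close>.\<close>
      have "frob B = (\<Sum>i<k. (singular_values B ! 0)\<^sup>2)"
        unfolding frob_eq_sum_singular_values[OF B'] by (intro sum.cong refl) (metis eq lessThan_iff)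
      hence "(singular_values B ! 0)\<^sup>2 = real k" using frob mn k by simp
      hence "singular_values B ! 0 = sqrt (real k)" using sv[of 0] k by (simp add: real_sqrt_unique)
      thus "\<forall>i<k. singular_values B ! i = sqrt (real k)" using eq by metis
    qed
    finally show ?thesis by blast
  qed
  moreover have "2 \<cdot>\<^sub>m A - ones_mat m m = B" if "m = n" using that by (simp add: B_def)
  ultimately show ?thesis unfolding B_def[symmetric] using main by metis
qed

end
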